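(* There exists a $2$-generator recursive presentation $Q$ such that the group $\overline{Q}$ it presents has $\mathrm{TorLen}(\overline{Q})=\infty$.
   Context: A recursive presentation is $\langle X\mid R\rangle$ with $X$ finite and $R$ a recursively enumerable set of words in $X^{\pm1}$. For a group $G$, define $\mathrm{Tor}_0(G)=\{e\}$ and inductively $\mathrm{Tor}_{i+1}(G)$ to be the normal closure in $G$ of $\{g\in G : g\,\mathrm{Tor}_i(G)\text{ has finite order in } G/\mathrm{Tor}_i(G)\}$; set $\mathrm{Tor}_\infty(G)=\bigcup_{i}\mathrm{Tor}_i(G)$. The torsion length $\mathrm{TorLen}(G)$ is the smallest $n\ge 0$ with $\mathrm{Tor}_n(G)=\mathrm{Tor}_\infty(G)$, and $\infty$ if no such $n$ exists. *)

theory Defs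
  imports "HOL-Algebra.Generated_Groups" "HOL-Library.Nat_Bijection"
begin

datatype recf = Zero | Succ | Proj nat | Comp recf "recf list" | Prim recf recf | Mu recf

inductive eval :: "recf \<Rightarrow> nat list \<Rightarrow> nat \<Rightarrow> bool" where
  ev_zero: "eval Zero xs 0"
| ev_succ: "eval Succ (x # xs) (Suc x)"
| ev_proj: "i < length xs \<Longrightarrow> eval (Proj i) xs (xs ! i)"
| ev_comp: "list_all2 (\<lambda>g y. eval g xs y) gs ys \<Longrightarrow> eval f ys z \<Longrightarrow> eval (Comp f gs) xs z"
| ev_prim0: "eval f xs y \<Longrightarrow> eval (Prim f g) (0 # xs) y"
| ev_primS: "eval (Prim f g) (n # xs) r \<Longrightarrow> eval g (r # n # xs) y
             \<Longrightarrow> eval (Prim f g) (Suc n # xs) y"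
| ev_mu: "eval f (y # xs) 0 \<Longrightarrow> (\<forall>z<y. \<exists>m. eval f (z # xs) (Suc m))
          \<Longrightarrow> eval (Mu f) xs y"

definition rec_enum :: "nat set \<Rightarrow> bool" where
  "rec_enum A \<longleftrightarrow> (\<exists>f. A = {n. \<exists>y. eval f [n] y})"

text \<open>A letter is (generator, sign); sign True means x, False means x^-1.\<close>
type_synonym letter = "bool \<times> bool"
type_synonym word = "letter list"

definition letter_inv :: "letter \<Rightarrow> letter" where
  "letter_inv l = (fst l, \<not> snd l)"

definition letter_code :: "letter \<Rightarrow> nat" where
  "letter_code l = 2 * of_bool (fst l) + of_bool (snd l)"

definition word_code :: "word \<Rightarrow> nat" where
  "word_code w = list_encode (map letter_code w)"

definition recursive_presentation :: "word set \<Rightarrow> bool" where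
  "recursive_presentation R \<longleftrightarrow> rec_enum (word_code ` R)"

inductive pres_eq :: "word set \<Rightarrow> word \<Rightarrow> word \<Rightarrow> bool" for R where
  pe_refl: "pres_eq R w w"
| pe_sym: "pres_eq R u v \<Longrightarrow> pres_eq R v u"
| pe_trans: "pres_eq R u v \<Longrightarrow> pres_eq R v w \<Longrightarrow> pres_eq R u w"
| pe_cancel: "pres_eq R (u @ [x, letter_inv x] @ v) (u @ v)"
| pe_rel: "r \<in> R \<Longrightarrow> pres_eq R (u @ r @ v) (u @ v)"

definition pres_group :: "word set \<Rightarrow> word set monoid" where
  "pres_group R = \<lparr> carrier = {{v. pres_eq R w v} | w. True},
     mult = (\<lambda>A B. {v. \<exists>a\<in>A. \<exists>b\<in>B. pres_eq R (a @ b) v}),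
     one = {v. pres_eq R [] v} \<rparr>"

definition normal_closure :: "('a, 'b) monoid_scheme \<Rightarrow> 'a set \<Rightarrow> 'a set" where
  "normal_closure G S = generate G {h \<otimes>\<^bsub>G\<^esub> s \<otimes>\<^bsub>G\<^esub> inv\<^bsub>G\<^esub> h | h s. h \<in> carrier G \<and> s \<in> S}"

fun Tor :: "('a, 'b) monoid_scheme \<Rightarrow> nat \<Rightarrow> 'a set" where
  "Tor G 0 = {\<one>\<^bsub>G\<^esub>}"
| "Tor G (Suc i) = normal_closure G
     {g \<in> carrier G. \<exists>n::nat. n > 0 \<and>
        (Tor G i #>\<^bsub>G\<^esub> g) [^]\<^bsub>G Mod Tor G i\<^esub> n = \<one>\<^bsub>G Mod Tor G i\<^esub>}"

definition Tor_infty :: "('a, 'b) monoid_scheme \<Rightarrow> 'a set" where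
  "Tor_infty G = (\<Union>i. Tor G i)"

definition TorLen_infinite :: "('a, 'b) monoid_scheme \<Rightarrow> bool" where
  "TorLen_infinite G \<longleftrightarrow> (\<forall>n. Tor G n \<noteq> Tor_infty G)"

end

theory Submission
  imports Defs
begin

text \<open>
  An endomorphism \<open>f\<close> of a group \<open>K\<close> that kills all torsion elements bounds the torsion series:
  the \<open>i\<close>-th iterate of \<open>f\<close> kills \<open>Tor K i\<close>, and likewise the image of \<open>Tor G i\<close> under every
  homomorphism from \<open>G\<close> to \<open>K\<close>. There is a metabelian group \<open>H\<close> of sequences of plane isometries
  whose shift \<open>f\<close> kills torsion, with elements \<open>x_i\<close> such that \<open>x_0\<close> has order 2, \<open>x_i\<close>
  inverts the square of \<open>x_(i+1)\<close>, and the \<open>i\<close>-fold shift of \<open>x_i\<close> is \<open>x_0\<close>. The relations put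
  \<open>x_i\<close> into \<open>Tor H (i+1)\<close>, since modulo \<open>x_i\<close> the fourth power of \<open>x_(i+1)\<close> is trivial; the shift
  keeps \<open>x_i\<close> out of \<open>Tor H i\<close>.

  Torsion-killing endomorphisms extend to unrestricted wreath products with the integers. In the
  double wreath product over \<open>H\<close> there are elements \<open>a\<close>, \<open>t\<close> for which the commutator of \<open>a\<close>
  with its conjugate by the \<open>(2i+1)\<close>-st power of \<open>t\<close> is a copy of \<open>x_i\<close>. Imposing the relations
  between the \<open>x_i\<close> on these commutators defines the presentation.
\<close>

section \<open>The torsion series\<close>

definition commutator :: "('a, 'b) monoid_scheme \<Rightarrow> 'a \<Rightarrow> 'a \<Rightarrow> 'a" where
  "commutator G x y = x \<otimes>\<^bsub>G\<^esub> y \<otimes>\<^bsub>G\<^esub> inv\<^bsub>G\<^esub> x \<otimes>\<^bsub>G\<^esub> inv\<^bsub>G\<^esub> y"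

context group
begin

lemma normal_closure_normal:
  assumes "S \<subseteq> carrier G"
  shows "normal_closure G S \<lhd> G"
  unfolding normal_closure_def
proof (rule normal_generateI)
  show "{h \<otimes> s \<otimes> inv h |h s. h \<in> carrier G \<and> s \<in> S} \<subseteq> carrier G"
    using assms by auto
next
  fix x g
  assume "x \<in> {h \<otimes> s \<otimes> inv h |h s. h \<in> carrier G \<and> s \<in> S}" and g: "g \<in> carrier G"
  then obtain h s where x: "x = h \<otimes> s \<otimes> inv h" and h: "h \<in> carrier G" and s: "s \<in> S" by blast
  have "s \<in> carrier G" using s assms by blast
  then have "g \<otimes> x \<otimes> inv g = (g \<otimes> h) \<otimes> s \<otimes> inv (g \<otimes> h)"
    using g h by (simp add: x inv_mult_group m_assoc)
  then show "g \<otimes> x \<otimes> inv g \<in> {h \<otimes> s \<otimes> inv h |h s. h \<in> carrier G \<and> s \<in> S}"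
    using g h s by blast
qed

lemma normal_closure_incl:
  assumes "S \<subseteq> carrier G" "s \<in> S"
  shows "s \<in> normal_closure G S"
proof -
  have "s = \<one> \<otimes> s \<otimes> inv \<one>" using assms by auto
  then show ?thesis
    unfolding normal_closure_def using assms by (intro generate.incl) blast
qed

lemma normal_closure_minimal:
  assumes "N \<lhd> G" "S \<subseteq> N"
  shows "normal_closure G S \<subseteq> N"
  unfolding normal_closure_def
  using assms normal_inv_iff by (intro generate_subgroup_incl) auto

lemma Tor_normal: "Tor G i \<lhd> G"
proof (cases i)
  case 0 then show ?thesis by (simp add: one_is_normal)
next
  case (Suc n) show ?thesis unfolding Suc Tor.simps by (rule normal_closure_normal) blast
qed

text \<open>Powers of a coset are taken on representatives because \<open>Tor G i\<close> is normal.
  This removes the quotient group from the arguments below.\<close>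

lemma Tor_coset_pow_iff:
  assumes "g \<in> carrier G"
  shows "(Tor G i #> g) [^]\<^bsub>G Mod Tor G i\<^esub> (n::nat) = \<one>\<^bsub>G Mod Tor G i\<^esub> \<longleftrightarrow> g [^] n \<in> Tor G i"
proof -
  interpret N: normal "Tor G i" G by (rule Tor_normal)
  show ?thesis
    using assms coset_join1[OF _ _ N.is_subgroup, of "g [^] n"] coset_join2[OF _ N.is_subgroup, of "g [^] n"]
    by (auto simp: N.FactGroup_pow)
qed

lemma in_Tor_Suc:
  assumes "g \<in> carrier G" "n > 0" "g [^] (n::nat) \<in> Tor G i"
  shows "g \<in> Tor G (Suc i)"
  unfolding Tor.simps
  using assms by (intro normal_closure_incl) (auto simp: Tor_coset_pow_iff simp del: one_FactGroup)

lemma Tor_Suc_minimal: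
  assumes "N \<lhd> G" "\<And>g n. g \<in> carrier G \<Longrightarrow> n > 0 \<Longrightarrow> g [^] (n::nat) \<in> Tor G i \<Longrightarrow> g \<in> N"
  shows "Tor G (Suc i) \<subseteq> N"
  unfolding Tor.simps
  using assms by (intro normal_closure_minimal) (auto simp: Tor_coset_pow_iff simp del: one_FactGroup)

text \<open>Modulo \<open>Tor G i\<close> the element \<open>x\<close> disappears and the relation
  reads \<open>y^4 = 1\<close>.\<close>

lemma inverted_square_in_Tor:
  assumes x: "x \<in> Tor G i" and y: "y \<in> carrier G"
    and rel: "x \<otimes> (y \<otimes> y) \<otimes> inv x \<otimes> (y \<otimes> y) = \<one>"
  shows "y \<in> Tor G (Suc i)"
proof -
  interpret N: normal "Tor G i" G by (rule Tor_normal)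
  have xc: "x \<in> carrier G" using x N.subset by blast
  define q where "q = y \<otimes> y"
  have q: "q \<in> carrier G" unfolding q_def using y by simp
  have "x \<otimes> q \<otimes> inv x = inv q"
    using rel inv_equality[of "x \<otimes> q \<otimes> inv x" q] q xc by (simp add: q_def[symmetric])
  \<comment> \<open>The right side is \<open>x\<close> times a conjugate of \<open>inv x\<close>, so
    normality places it in \<open>Tor G i\<close>.\<close>
  then have "inv (q \<otimes> q) = x \<otimes> (q \<otimes> inv x \<otimes> inv q)"
    using q xc by (simp add: inv_mult_group m_assoc[symmetric])
  moreover have "q \<otimes> inv x \<otimes> inv q \<in> Tor G i" using x q N.inv_op_closed2 by simp
  ultimately have "inv (q \<otimes> q) \<in> Tor G i" using x by simp
  then have "q \<otimes> q \<in> Tor G i" using q N.m_inv_closed by fastforce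
  moreover have "y [^] (4::nat) = q \<otimes> q"
    using y by (simp add: numeral_eq_Suc q_def m_assoc)
  ultimately show ?thesis using y by (intro in_Tor_Suc[of _ 4]) auto
qed

end

section \<open>Endomorphisms that kill torsion\<close>

definition kills_torsion :: "('a, 'b) monoid_scheme \<Rightarrow> ('a \<Rightarrow> 'a) \<Rightarrow> bool" where
  "kills_torsion G f \<longleftrightarrow> f \<in> hom G G \<and>
     (\<forall>g\<in>carrier G. \<forall>n::nat. n > 0 \<longrightarrow> g [^]\<^bsub>G\<^esub> n = \<one>\<^bsub>G\<^esub> \<longrightarrow> f g = \<one>\<^bsub>G\<^esub>)"

lemma hom_funpow: "f \<in> hom G G \<Longrightarrow> (f ^^ n) \<in> hom G G"
  by (induction n) (auto simp: hom_def Pi_def)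

text \<open>By induction, if a positive power of \<open>g\<close> lies in \<open>Tor G i\<close>,
  then \<open>(f ^^ i) \<circ> \<phi>\<close> sends \<open>g\<close> to a torsion element, which one
  more \<open>f\<close> kills. The kernel of the new map is normal, so it contains the whole normal
  closure. Separating \<open>G\<close> from \<open>K\<close> allows \<open>G\<close> to be a
  presented group and \<open>K\<close> a concrete one.\<close>

lemma Tor_killed:
  assumes "group G" "group K" "\<phi> \<in> hom G K" "kills_torsion K f" "g \<in> Tor G i"
  shows "(f ^^ i) (\<phi> g) = \<one>\<^bsub>K\<^esub>"
  using \<open>g \<in> Tor G i\<close>
proof (induction i arbitrary: g)
  case 0
  then show ?case using hom_one[OF assms(3,1,2)] by simp
next
  case (Suc i)
  interpret G: group G by fact
  have f: "f \<in> hom K K" using assms(4) by (simp add: kills_torsion_def)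
  have hom: "(f ^^ j) \<circ> \<phi> \<in> hom G K" for j
    using hom_compose[OF assms(3) hom_funpow[OF f]] .
  interpret h: group_hom G K "(f ^^ i) \<circ> \<phi>"
    using hom assms by (intro group_hom.intro group_hom_axioms.intro)
  interpret h': group_hom G K "(f ^^ Suc i) \<circ> \<phi>"
    using hom assms by (intro group_hom.intro group_hom_axioms.intro)
  have "Tor G (Suc i) \<subseteq> kernel G K ((f ^^ Suc i) \<circ> \<phi>)"
  proof (rule G.Tor_Suc_minimal[OF h'.normal_kernel])
    fix g and n :: nat
    assume g: "g \<in> carrier G" "n > 0" "g [^]\<^bsub>G\<^esub> n \<in> Tor G i"
    then have "((f ^^ i) \<circ> \<phi>) g [^]\<^bsub>K\<^esub> n = \<one>\<^bsub>K\<^esub>"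
      using Suc.IH[OF g(3)] h.hom_nat_pow[of g n] by simp
    then have "f (((f ^^ i) \<circ> \<phi>) g) = \<one>\<^bsub>K\<^esub>"
      using assms(4) g h.hom_closed unfolding kills_torsion_def by blast
    then show "g \<in> kernel G K ((f ^^ Suc i) \<circ> \<phi>)" using g by (simp add: kernel_def)
  qed
  then show ?case using Suc.prems by (auto simp: kernel_def)
qed

section \<open>Unrestricted wreath products with the integers\<close>

definition wreath :: "('a, 'b) monoid_scheme \<Rightarrow> ((int \<Rightarrow> 'a) \<times> int) monoid" where
  "wreath G = \<lparr> carrier = (UNIV \<rightarrow> carrier G) \<times> UNIV,
     mult = (\<lambda>(\<alpha>, i) (\<beta>, j). (\<lambda>k. \<alpha> k \<otimes>\<^bsub>G\<^esub> \<beta> (k - i), i + j)),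
     one = (\<lambda>_. \<one>\<^bsub>G\<^esub>, 0) \<rparr>"

definition wreath_base :: "(int \<Rightarrow> 'a) \<Rightarrow> (int \<Rightarrow> 'a) \<times> int" where
  "wreath_base \<alpha> = (\<alpha>, 0)"

definition wreath_shift :: "('a, 'b) monoid_scheme \<Rightarrow> (int \<Rightarrow> 'a) \<times> int" where
  "wreath_shift G = (\<lambda>_. \<one>\<^bsub>G\<^esub>, 1)"

definition wreath_single :: "('a, 'b) monoid_scheme \<Rightarrow> 'a \<Rightarrow> (int \<Rightarrow> 'a) \<times> int" where
  "wreath_single G x = wreath_base (\<lambda>k. if k = 0 then x else \<one>\<^bsub>G\<^esub>)"

definition wreath_map :: "('a \<Rightarrow> 'c) \<Rightarrow> (int \<Rightarrow> 'a) \<times> int \<Rightarrow> (int \<Rightarrow> 'c) \<times> int" where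
  "wreath_map f = (\<lambda>(\<alpha>, i). (f \<circ> \<alpha>, i))"

context group
begin

lemma wreath_group: "group (wreath G)"
proof (rule groupI)
  fix x assume "x \<in> carrier (wreath G)"
  then obtain \<alpha> i where x: "x = (\<alpha>, i)" "\<And>k. \<alpha> k \<in> carrier G" by (auto simp: wreath_def)
  then show "\<exists>y\<in>carrier (wreath G). y \<otimes>\<^bsub>wreath G\<^esub> x = \<one>\<^bsub>wreath G\<^esub>"
    by (intro bexI[of _ "(\<lambda>k. inv (\<alpha> (k + i)), - i)"]) (auto simp: wreath_def)
qed (auto simp: wreath_def Pi_def m_assoc algebra_simps)

lemma wreath_inv:
  assumes "\<And>k. \<alpha> k \<in> carrier G"
  shows "inv\<^bsub>wreath G\<^esub> (\<alpha>, i) = (\<lambda>k. inv (\<alpha> (k + i)), - i)"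
  by (rule group.inv_equality[OF wreath_group]) (use assms in \<open>auto simp: wreath_def\<close>)

lemma wreath_shift_closed: "wreath_shift G \<in> carrier (wreath G)"
  by (simp add: wreath_shift_def wreath_def)

lemma wreath_base_closed: "(\<And>k. \<alpha> k \<in> carrier G) \<Longrightarrow> wreath_base \<alpha> \<in> carrier (wreath G)"
  by (simp add: wreath_base_def wreath_def)

lemma wreath_shift_pow: "wreath_shift G [^]\<^bsub>wreath G\<^esub> (n::nat) = (\<lambda>_. \<one>, int n)"
  by (induction n) (auto simp: wreath_shift_def wreath_def)

text \<open>Conjugation by the shift translates \<open>\<alpha>\<close> by one, so the commutator is
  a difference operator: a function constant on a half-line and trivial off it becomes one supported
  at a single point.\<close>

lemma wreath_shift_commutator:
  assumes "\<And>k. \<alpha> k \<in> carrier G"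
  shows "commutator (wreath G) (wreath_shift G) (wreath_base \<alpha>)
    = wreath_base (\<lambda>k. \<alpha> (k - 1) \<otimes> inv (\<alpha> k))"
  using assms
  by (simp add: commutator_def wreath_shift_def wreath_base_def wreath_inv) (simp add: wreath_def)

text \<open>Conjugation by \<open>t\<close> translates the argument and stays in the base, where
  multiplication is pointwise.\<close>

lemma wreath_base_commutator:
  fixes n :: nat
  assumes "\<And>k. \<alpha> k \<in> carrier G"
  defines "t \<equiv> wreath_shift G [^]\<^bsub>wreath G\<^esub> n"
  shows "commutator (wreath G) (wreath_base \<alpha>)
      (inv\<^bsub>wreath G\<^esub> t \<otimes>\<^bsub>wreath G\<^esub> wreath_base \<alpha> \<otimes>\<^bsub>wreath G\<^esub> t)
    = wreath_base (\<lambda>k. commutator G (\<alpha> k) (\<alpha> (k + int n)))"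
proof -
  have "inv\<^bsub>wreath G\<^esub> t \<otimes>\<^bsub>wreath G\<^esub> wreath_base \<alpha> \<otimes>\<^bsub>wreath G\<^esub> t = (\<lambda>k. \<alpha> (k + int n), 0)"
    unfolding t_def using assms(1)
    by (simp add: wreath_shift_pow wreath_base_def wreath_inv) (simp add: wreath_def)
  then show ?thesis
    using assms(1) by (simp add: commutator_def wreath_base_def wreath_inv) (simp add: wreath_def)
qed

lemma wreath_single_hom: "wreath_single G \<in> hom G (wreath G)"
  by (auto simp: hom_def wreath_single_def wreath_base_def wreath_def)

lemma wreath_map_single:
  assumes "f \<in> hom G G"
  shows "wreath_map f (wreath_single G x) = wreath_single G (f x)"
  using hom_one[OF assms is_group is_group]
  by (auto simp: wreath_map_def wreath_single_def wreath_base_def fun_eq_iff)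

lemma wreath_single_eq_one_iff: "wreath_single G x = \<one>\<^bsub>wreath G\<^esub> \<longleftrightarrow> x = \<one>"
  by (auto simp: wreath_single_def wreath_base_def wreath_def fun_eq_iff)

lemma wreath_nat_pow_snd: "snd (g [^]\<^bsub>wreath G\<^esub> (n::nat)) = int n * snd g"
  by (induction n) (auto simp: wreath_def case_prod_unfold algebra_simps)

lemma wreath_base_nat_pow:
  assumes "\<And>k. \<alpha> k \<in> carrier G"
  shows "wreath_base \<alpha> [^]\<^bsub>wreath G\<^esub> (n::nat) = wreath_base (\<lambda>k. \<alpha> k [^] n)"
  by (induction n) (auto simp: wreath_base_def wreath_def)

text \<open>The integers are torsion-free, so a torsion element lies in the base and all its values
  are torsion in \<open>G\<close>.\<close>

lemma wreath_kills_torsion: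
  assumes "kills_torsion G f"
  shows "kills_torsion (wreath G) (wreath_map f)"
  unfolding kills_torsion_def
proof (intro conjI ballI allI impI)
  have f: "f \<in> hom G G" using assms by (simp add: kills_torsion_def)
  then show "wreath_map f \<in> hom (wreath G) (wreath G)"
    by (auto simp: hom_def wreath_map_def wreath_def Pi_def)
  fix g and n :: nat
  assume g: "g \<in> carrier (wreath G)" "n > 0" "g [^]\<^bsub>wreath G\<^esub> n = \<one>\<^bsub>wreath G\<^esub>"
  then have "int n * snd g = 0" using wreath_nat_pow_snd[of g n] by (simp add: wreath_def)
  then obtain \<alpha> where \<alpha>: "g = wreath_base \<alpha>" "\<And>k. \<alpha> k \<in> carrier G"
    using g by (cases g) (auto simp: wreath_def wreath_base_def)
  have "(\<lambda>k. \<alpha> k [^] n) = (\<lambda>_. \<one>)"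
    using g(3) \<alpha> by (simp add: wreath_base_nat_pow) (simp add: wreath_base_def wreath_def)
  then have "\<alpha> k [^] n = \<one>" for k by meson
  then have "f (\<alpha> k) = \<one>" for k using assms \<alpha>(2) g(2) by (auto simp: kills_torsion_def)
  then show "wreath_map f g = \<one>\<^bsub>wreath G\<^esub>"
    by (auto simp: \<alpha> wreath_map_def wreath_base_def wreath_def)
qed

text \<open>The inner wreath product makes each \<open>x i\<close> a commutator of one fixed
  \<open>b\<close> with some \<open>c i\<close>; the outer one stores \<open>b\<close> and all the
  \<open>c i\<close> in a single function. This is in the style of the embedding of countable groups
  into two-generator groups by B. H. Neumann and H. Neumann.\<close>

lemma two_generator_double_wreath:
  fixes x :: "nat \<Rightarrow> 'a"
  assumes x: "\<And>i. x i \<in> carrier G"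
  obtains a where "a \<in> carrier (wreath (wreath G))"
    and "\<And>i. commutator (wreath (wreath G)) a
      (inv\<^bsub>wreath (wreath G)\<^esub> (wreath_shift (wreath G) [^]\<^bsub>wreath (wreath G)\<^esub> (2 * i + 1))
        \<otimes>\<^bsub>wreath (wreath G)\<^esub> a
        \<otimes>\<^bsub>wreath (wreath G)\<^esub> (wreath_shift (wreath G) [^]\<^bsub>wreath (wreath G)\<^esub> (2 * i + 1)))
      = wreath_single (wreath G) (wreath_single G (x i))"
proof -
  interpret W: group "wreath G" by (rule wreath_group)
  define b where "b = wreath_shift G"
  \<comment> \<open>The differences of this step function are trivial except at
    \<open>k = 0\<close>, where the value drops from \<open>x i\<close> to the identity.\<close>
  define c where "c i = wreath_base (\<lambda>k. if k < 0 then x i else \<one>)" for i :: nat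
  have b: "b \<in> carrier (wreath G)" unfolding b_def by (rule wreath_shift_closed)
  have c: "c i \<in> carrier (wreath G)" for i
    unfolding c_def using x by (intro wreath_base_closed) auto
  have bc: "commutator (wreath G) b (c i) = wreath_single G (x i)" for i
    unfolding b_def c_def using x
    by (subst wreath_shift_commutator) (auto simp: wreath_single_def intro!: arg_cong[of _ _ wreath_base])
  \<comment> \<open>Position \<open>2 * i + 1\<close> holds \<open>c i\<close>, since there
    \<open>k div 2\<close> is \<open>i\<close>.\<close>
  define \<alpha> where "\<alpha> k = (if k = 0 then b else if k > 0 \<and> odd k then c (nat (k div 2)) else \<one>\<^bsub>wreath G\<^esub>)"
    for k :: int
  have \<alpha>: "\<alpha> k \<in> carrier (wreath G)" for k unfolding \<alpha>_def using b c by auto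
  have one: "commutator (wreath G) g \<one>\<^bsub>wreath G\<^esub> = \<one>\<^bsub>wreath G\<^esub>"
    "commutator (wreath G) \<one>\<^bsub>wreath G\<^esub> g = \<one>\<^bsub>wreath G\<^esub>" if "g \<in> carrier (wreath G)" for g
    using that by (auto simp: commutator_def)
  \<comment> \<open>The support of \<open>\<alpha>\<close> is 0 and the odd positive integers, so two of its points differ by an
    odd number only if one of them is 0.\<close>
  have "commutator (wreath G) (\<alpha> k) (\<alpha> (k + int (2 * i + 1)))
      = (if k = 0 then wreath_single G (x i) else \<one>\<^bsub>wreath G\<^esub>)" for k i
  proof (cases "k = 0")
    case True
    have "\<alpha> (0 + int (2 * i + 1)) = c i" by (simp add: \<alpha>_def)
    then show ?thesis using True bc by (simp add: \<alpha>_def)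
  next
    case False
    have "\<alpha> k = \<one>\<^bsub>wreath G\<^esub> \<or> \<alpha> (k + int (2 * i + 1)) = \<one>\<^bsub>wreath G\<^esub>"
      using False by (auto simp: \<alpha>_def)
    then show ?thesis using False one[OF \<alpha>] by metis
  qed
  then have "(\<lambda>k. commutator (wreath G) (\<alpha> k) (\<alpha> (k + int (2 * i + 1))))
      = (\<lambda>k. if k = 0 then wreath_single G (x i) else \<one>\<^bsub>wreath G\<^esub>)" for i by blast
  then show thesis
    by (intro that[of "wreath_base \<alpha>"] W.wreath_base_closed \<alpha>)
      (simp only: W.wreath_base_commutator[of \<alpha>, OF \<alpha>] wreath_single_def[of "wreath G"])
qed

end

section \<open>A metabelian group whose shift kills torsion\<close>

text \<open>
  The entry \<open>(e i, m i, n i)\<close> stands for the plane isometry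
  \<open>(x, y) \<mapsto> (e i * x + m i, e i * e (Suc i) * y + n i)\<close>. If \<open>e (Suc i) = -1\<close> this is a glide
  reflection, because \<open>m i\<close> and \<open>n i\<close> are odd; so an element of finite order has
  \<open>e (Suc i) = 1\<close> for all \<open>i\<close>, and then every entry but the first is trivial.
\<close>

type_synonym signed_seq = "(nat \<Rightarrow> int) \<times> (nat \<Rightarrow> int) \<times> (nat \<Rightarrow> int)"

definition signed_seq_group :: "signed_seq monoid" where
  "signed_seq_group = \<lparr>
     carrier = {(e, m, n). \<forall>i. e i \<in> {1, -1} \<and>
       (odd (m i) \<longleftrightarrow> e (Suc i) = -1) \<and> (odd (n i) \<longleftrightarrow> e (Suc i) = -1)},
     mult = (\<lambda>(e, m, n) (e', m', n').
       (\<lambda>i. e i * e' i, \<lambda>i. m i + e i * m' i, \<lambda>i. n i + e i * e (Suc i) * n' i)),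
     one = (\<lambda>_. 1, \<lambda>_. 0, \<lambda>_. 0) \<rparr>"

definition seq_shift :: "signed_seq \<Rightarrow> signed_seq" where
  "seq_shift = (\<lambda>(e, m, n). (e \<circ> Suc, m \<circ> Suc, n \<circ> Suc))"

text \<open>A sign at \<open>j\<close> forces odd translations in entry \<open>j - 1\<close>. For
  \<open>j = 0\<close> there is no such entry, which leaves an element of order 2.\<close>

definition seq_gen :: "nat \<Rightarrow> signed_seq" where
  "seq_gen j = (\<lambda>i. if i = j then -1 else 1, \<lambda>i. of_bool (Suc i = j), \<lambda>i. of_bool (Suc i = j))"

lemma signed_seq_carrier_iff:
  "(e, m, n) \<in> carrier signed_seq_group \<longleftrightarrow>
    (\<forall>i. (e i = 1 \<or> e i = -1) \<and> (odd (m i) \<longleftrightarrow> e (Suc i) = -1) \<and> (odd (n i) \<longleftrightarrow> e (Suc i) = -1))"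
  by (simp add: signed_seq_group_def)

lemma signed_seq_mult:
  "(e, m, n) \<otimes>\<^bsub>signed_seq_group\<^esub> (e', m', n') =
    (\<lambda>i. e i * e' i, \<lambda>i. m i + e i * m' i, \<lambda>i. n i + e i * e (Suc i) * n' i)"
  by (simp add: signed_seq_group_def)

lemma signed_seq_one: "\<one>\<^bsub>signed_seq_group\<^esub> = (\<lambda>_. 1, \<lambda>_. 0, \<lambda>_. 0)"
  by (simp add: signed_seq_group_def)

text \<open>Signs do not affect parity, so the parities of the translations add up just as the signs
  \<open>e (Suc i)\<close> multiply; this keeps the carrier closed.\<close>

lemma signed_seq_group: "group signed_seq_group"
proof (rule groupI)
  fix x y assume xy: "x \<in> carrier signed_seq_group" "y \<in> carrier signed_seq_group"
  obtain e m n e' m' n' where [simp]: "x = (e, m, n)" "y = (e', m', n')" by (metis prod_cases3)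
  have e: "e i = 1 \<or> e i = -1" "e' i = 1 \<or> e' i = -1" for i
    using xy by (auto simp: signed_seq_carrier_iff)
  show "x \<otimes>\<^bsub>signed_seq_group\<^esub> y \<in> carrier signed_seq_group"
    unfolding \<open>x = _\<close> \<open>y = _\<close> signed_seq_mult signed_seq_carrier_iff
  proof (intro allI)
    fix i
    show "(e i * e' i = 1 \<or> e i * e' i = -1) \<and>
      (odd (m i + e i * m' i) \<longleftrightarrow> e (Suc i) * e' (Suc i) = -1) \<and>
      (odd (n i + e i * e (Suc i) * n' i) \<longleftrightarrow> e (Suc i) * e' (Suc i) = -1)"
      using e[of i] e[of "Suc i"] xy[simplified, unfolded signed_seq_carrier_iff, THEN spec[of _ i]]
      by (elim disjE conjE; simp)
  qed
next
  fix x assume x: "x \<in> carrier signed_seq_group"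
  obtain e m n where [simp]: "x = (e, m, n)" by (metis prod_cases3)
  have e: "e i = 1 \<or> e i = -1" for i using x by (auto simp: signed_seq_carrier_iff)
  have ee: "e i * e i = 1" "e i * (e i * k) = k" "e i * (e (Suc i) * (e i * (e (Suc i) * k))) = k" for i k
    using e[of i] e[of "Suc i"] by (elim disjE; simp)+
  let ?y = "(e, \<lambda>i. - (e i * m i), \<lambda>i. - (e i * e (Suc i) * n i))"
  have "?y \<in> carrier signed_seq_group"
    unfolding signed_seq_carrier_iff
  proof (intro allI)
    fix i
    show "(e i = 1 \<or> e i = -1) \<and> (odd (- (e i * m i)) \<longleftrightarrow> e (Suc i) = -1) \<and>
      (odd (- (e i * e (Suc i) * n i)) \<longleftrightarrow> e (Suc i) = -1)"
      using e[of i] e[of "Suc i"] x[simplified, unfolded signed_seq_carrier_iff, THEN spec[of _ i]]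
      by (elim disjE conjE; simp)
  qed
  moreover have "?y \<otimes>\<^bsub>signed_seq_group\<^esub> x = \<one>\<^bsub>signed_seq_group\<^esub>"
    by (simp add: signed_seq_mult signed_seq_one ee)
  ultimately show "\<exists>y\<in>carrier signed_seq_group. y \<otimes>\<^bsub>signed_seq_group\<^esub> x = \<one>\<^bsub>signed_seq_group\<^esub>"
    by blast
qed (auto simp: signed_seq_carrier_iff signed_seq_mult signed_seq_one algebra_simps)

lemma signed_seq_nat_pow_sign:
  "fst (g [^]\<^bsub>signed_seq_group\<^esub> (k::nat)) i = fst g i ^ k"
  by (induction k) (auto simp: signed_seq_group_def case_prod_unfold)

lemma signed_seq_nat_pow_fst:
  "fst g i = 1 \<Longrightarrow> fst (snd (g [^]\<^bsub>signed_seq_group\<^esub> (k::nat))) i = int k * fst (snd g) i"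
proof (induction k)
  case (Suc k)
  then show ?case
    using signed_seq_nat_pow_sign[of g k i]
    by (auto simp: signed_seq_group_def case_prod_unfold algebra_simps)
qed (simp add: signed_seq_group_def)

lemma signed_seq_nat_pow_snd:
  "fst g i * fst g (Suc i) = 1 \<Longrightarrow>
    snd (snd (g [^]\<^bsub>signed_seq_group\<^esub> (k::nat))) i = int k * snd (snd g) i"
proof (induction k)
  case (Suc k)
  then have "fst g i ^ k * fst g (Suc i) ^ k = 1" by (metis power_mult_distrib power_one)
  with Suc show ?case
    using signed_seq_nat_pow_sign[of g k i] signed_seq_nat_pow_sign[of g k "Suc i"]
    by (auto simp: signed_seq_group_def case_prod_unfold algebra_simps)
qed (simp add: signed_seq_group_def)

lemma seq_shift_kills_torsion: "kills_torsion signed_seq_group seq_shift"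
  unfolding kills_torsion_def
proof (intro conjI ballI allI impI)
  show "seq_shift \<in> hom signed_seq_group signed_seq_group"
    by (auto simp: hom_def seq_shift_def signed_seq_carrier_iff signed_seq_mult fun_eq_iff)
  fix g and k :: nat
  assume g: "g \<in> carrier signed_seq_group" "k > 0" "g [^]\<^bsub>signed_seq_group\<^esub> k = \<one>\<^bsub>signed_seq_group\<^esub>"
  obtain e m n where [simp]: "g = (e, m, n)" by (metis prod_cases3)
  have inv: "e i = 1 \<or> e i = -1" "odd (m i) \<longleftrightarrow> e (Suc i) = -1" "odd (n i) \<longleftrightarrow> e (Suc i) = -1" for i
    using g(1) by (auto simp: signed_seq_carrier_iff)
  have m: "m i = 0" if "e i = 1" for i
    using signed_seq_nat_pow_fst[of g i k] that g by (simp add: signed_seq_one)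
  have n: "n i = 0" if "e i * e (Suc i) = 1" for i
    using signed_seq_nat_pow_snd[of g i k] that g by (simp add: signed_seq_one)
  \<comment> \<open>If \<open>e (Suc i) = -1\<close>, then \<open>m i\<close> and \<open>n i\<close>
    are odd, but one of \<open>e i\<close> and \<open>e i * e (Suc i)\<close> is 1, so
    \<open>m i\<close> or \<open>n i\<close> is 0.\<close>
  have e: "e (Suc i) = 1" for i
    using inv[of i] inv(1)[of "Suc i"] m[of i] n[of i] by auto
  then show "seq_shift g = \<one>\<^bsub>signed_seq_group\<^esub>"
    using m n by (auto simp: seq_shift_def signed_seq_one)
qed

lemma seq_gen_closed: "seq_gen j \<in> carrier signed_seq_group"
  by (auto simp: seq_gen_def signed_seq_carrier_iff)

lemma seq_gen_0_square: "seq_gen 0 \<otimes>\<^bsub>signed_seq_group\<^esub> seq_gen 0 = \<one>\<^bsub>signed_seq_group\<^esub>"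
  by (auto simp: seq_gen_def signed_seq_mult signed_seq_one)

text \<open>The square of the glide reflection in entry \<open>j\<close> of
  \<open>seq_gen (Suc j)\<close> is the translation by 2 along the first axis, and
  \<open>seq_gen j\<close> reverses that axis.\<close>

lemma seq_gen_inverts_square:
  "seq_gen j \<otimes>\<^bsub>signed_seq_group\<^esub> (seq_gen (Suc j) \<otimes>\<^bsub>signed_seq_group\<^esub> seq_gen (Suc j))
     \<otimes>\<^bsub>signed_seq_group\<^esub> inv\<^bsub>signed_seq_group\<^esub> (seq_gen j)
     \<otimes>\<^bsub>signed_seq_group\<^esub> (seq_gen (Suc j) \<otimes>\<^bsub>signed_seq_group\<^esub> seq_gen (Suc j))
   = \<one>\<^bsub>signed_seq_group\<^esub>"
proof -
  interpret H: group signed_seq_group by (rule signed_seq_group)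
  let ?q = "(\<lambda>_. 1, \<lambda>i. 2 * of_bool (i = j), \<lambda>_. 0)"
  have q: "seq_gen (Suc j) \<otimes>\<^bsub>signed_seq_group\<^esub> seq_gen (Suc j) = ?q"
    by (auto simp: seq_gen_def signed_seq_mult)
  have qc: "?q \<in> carrier signed_seq_group" by (auto simp: signed_seq_carrier_iff)
  \<comment> \<open>This form of the relation contains no inverse, so both sides can be computed
    entrywise.\<close>
  have "?q \<otimes>\<^bsub>signed_seq_group\<^esub> (seq_gen j \<otimes>\<^bsub>signed_seq_group\<^esub> ?q) = seq_gen j"
    by (auto simp: seq_gen_def signed_seq_mult)
  then have "seq_gen j \<otimes>\<^bsub>signed_seq_group\<^esub> ?q = inv\<^bsub>signed_seq_group\<^esub> ?q \<otimes>\<^bsub>signed_seq_group\<^esub> seq_gen j"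
    using qc seq_gen_closed H.inv_solve_left by (metis H.m_closed)
  then show ?thesis unfolding q using qc seq_gen_closed[of j] by (simp add: H.m_assoc)
qed

lemma seq_shift_gen: "(seq_shift ^^ j) (seq_gen j) = seq_gen 0"
proof (induction j)
  case (Suc j)
  have "seq_shift (seq_gen (Suc j)) = seq_gen j" by (auto simp: seq_shift_def seq_gen_def)
  then show ?case using Suc by (simp add: funpow_swap1)
qed simp

lemma seq_gen_0_neq_one: "seq_gen 0 \<noteq> \<one>\<^bsub>signed_seq_group\<^esub>"
  by (auto simp: seq_gen_def signed_seq_one fun_eq_iff)

section \<open>Presented groups\<close>

definition word_inv :: "word \<Rightarrow> word" where
  "word_inv w = rev (map letter_inv w)"

definition word_commutator :: "word \<Rightarrow> word \<Rightarrow> word" where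
  "word_commutator u v = u @ v @ word_inv u @ word_inv v"

definition word_class :: "word set \<Rightarrow> word \<Rightarrow> word set" where
  "word_class R w = {v. pres_eq R w v}"

lemma word_inv_append: "word_inv (u @ v) = word_inv v @ word_inv u"
  by (simp add: word_inv_def)

lemma word_inv_Nil: "word_inv [] = []"
  by (simp add: word_inv_def)

lemma word_inv_Cons: "word_inv (l # w) = word_inv w @ [letter_inv l]"
  by (simp add: word_inv_def)

lemma word_inv_replicate: "word_inv (replicate n l) = replicate n (letter_inv l)"
  by (simp add: word_inv_def)

lemma letter_inv_inv: "letter_inv (letter_inv l) = l"
  by (simp add: letter_inv_def)

lemma pres_eq_context: "pres_eq R u v \<Longrightarrow> pres_eq R (p @ u @ q) (p @ v @ q)"
proof (induction rule: pres_eq.induct)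
  case (pe_cancel u x v)
  show ?case using pres_eq.pe_cancel[of R "p @ u" x "v @ q"] by simp
next
  case (pe_rel r u v)
  show ?case using pres_eq.pe_rel[OF pe_rel, of "p @ u" "v @ q"] by simp
qed (blast intro: pres_eq.intros)+

lemma pres_eq_append:
  assumes "pres_eq R u u'" "pres_eq R v v'"
  shows "pres_eq R (u @ v) (u' @ v')"
  using pe_trans pres_eq_context[OF assms(1), of "[]" v] pres_eq_context[OF assms(2), of u' "[]"]
  by fastforce

lemma pres_eq_inv_left: "pres_eq R (word_inv w @ w) []"
proof (induction w)
  case Nil show ?case by (simp add: word_inv_Nil pe_refl)
next
  case (Cons l w)
  \<comment> \<open>\<open>pe_cancel\<close> removes a letter followed by its inverse, so it is
    applied to \<open>letter_inv l\<close>, whose inverse is \<open>l\<close>.\<close>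
  have "pres_eq R (word_inv w @ [letter_inv l, letter_inv (letter_inv l)] @ w) (word_inv w @ w)"
    by (rule pe_cancel)
  then have "pres_eq R (word_inv (l # w) @ l # w) (word_inv w @ w)"
    by (simp add: letter_inv_inv word_inv_Cons)
  then show ?case using Cons pe_trans by blast
qed

lemma word_class_eq_iff: "word_class R u = word_class R v \<longleftrightarrow> pres_eq R u v"
  unfolding word_class_def by (blast intro: pe_refl pe_sym pe_trans)

lemma carrier_pres_group: "carrier (pres_group R) = range (word_class R)"
  by (auto simp: pres_group_def word_class_def)

lemma word_class_closed: "word_class R w \<in> carrier (pres_group R)"
  by (simp add: carrier_pres_group)

lemma word_class_mult: "word_class R u \<otimes>\<^bsub>pres_group R\<^esub> word_class R v = word_class R (u @ v)"
proof -
  have "pres_eq R (u @ v) x" if "pres_eq R u a" "pres_eq R v b" "pres_eq R (a @ b) x" for a b x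
    using that pres_eq_append pe_trans by blast
  then show ?thesis by (auto simp: pres_group_def word_class_def intro: pe_refl)
qed

lemma word_class_Nil: "word_class R [] = \<one>\<^bsub>pres_group R\<^esub>"
  by (simp add: pres_group_def word_class_def)

lemma pres_group_group: "group (pres_group R)"
proof (rule groupI)
  fix x assume "x \<in> carrier (pres_group R)"
  then obtain w where x: "x = word_class R w" by (auto simp: carrier_pres_group)
  have "word_class R (word_inv w) \<otimes>\<^bsub>pres_group R\<^esub> x = \<one>\<^bsub>pres_group R\<^esub>"
    by (simp add: x word_class_mult word_class_Nil[symmetric] word_class_eq_iff pres_eq_inv_left)
  then show "\<exists>y\<in>carrier (pres_group R). y \<otimes>\<^bsub>pres_group R\<^esub> x = \<one>\<^bsub>pres_group R\<^esub>"
    using word_class_closed by blast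
qed (auto simp: carrier_pres_group word_class_mult word_class_Nil[symmetric])

lemma word_class_inv: "word_class R (word_inv w) = inv\<^bsub>pres_group R\<^esub> (word_class R w)"
  by (rule group.inv_equality[OF pres_group_group, symmetric])
    (simp_all add: word_class_closed word_class_mult word_class_Nil[symmetric]
      word_class_eq_iff pres_eq_inv_left)

lemma word_class_relator: "r \<in> R \<Longrightarrow> word_class R r = \<one>\<^bsub>pres_group R\<^esub>"
  using pe_rel[of r R "[]" "[]"] by (simp add: word_class_Nil[symmetric] word_class_eq_iff)

section \<open>Evaluation of words at two chosen group elements\<close>

definition letter_value :: "('a, 'b) monoid_scheme \<Rightarrow> (bool \<Rightarrow> 'a) \<Rightarrow> letter \<Rightarrow> 'a" where
  "letter_value G h l = (if snd l then h (fst l) else inv\<^bsub>G\<^esub> h (fst l))"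

definition word_value :: "('a, 'b) monoid_scheme \<Rightarrow> (bool \<Rightarrow> 'a) \<Rightarrow> word \<Rightarrow> 'a" where
  "word_value G h w = foldr (\<lambda>l g. letter_value G h l \<otimes>\<^bsub>G\<^esub> g) w \<one>\<^bsub>G\<^esub>"

locale two_generated = group G for G (structure) +
  fixes h :: "bool \<Rightarrow> 'a"
  assumes gen_closed [simp]: "h b \<in> carrier G"
begin

abbreviation "val \<equiv> word_value G h"

lemma letter_value_closed [simp]: "letter_value G h l \<in> carrier G"
  by (simp add: letter_value_def)

lemma word_value_Nil [simp]: "val [] = \<one>"
  by (simp add: word_value_def)

lemma word_value_Cons: "val (l # w) = letter_value G h l \<otimes> val w"
  by (simp add: word_value_def)

lemma word_value_closed [simp]: "val w \<in> carrier G"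
  by (induction w) (simp_all add: word_value_Cons)

lemma word_value_append: "val (u @ v) = val u \<otimes> val v"
  by (induction u) (simp_all add: word_value_Cons m_assoc)

lemma letter_value_inv: "letter_value G h (letter_inv l) = inv (letter_value G h l)"
  by (simp add: letter_value_def letter_inv_def)

lemma word_value_inv: "val (word_inv w) = inv (val w)"
  by (induction w)
    (simp_all add: word_inv_Nil word_inv_Cons word_value_append word_value_Cons letter_value_inv
      inv_mult_group)

lemma word_value_commutator: "val (word_commutator u v) = commutator G (val u) (val v)"
  by (simp add: word_commutator_def commutator_def word_value_append word_value_inv m_assoc)

lemma word_value_generator: "val [(b, True)] = h b"
  by (simp add: word_value_Cons letter_value_def)

lemma word_value_replicate: "val (replicate n (b, True)) = h b [^] n"
proof (induction n)
  case (Suc n)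
  have "val (replicate (Suc n) (b, True)) = val (replicate n (b, True)) \<otimes> val [(b, True)]"
    by (simp add: word_value_append[symmetric] replicate_append_same)
  then show ?case by (simp add: Suc word_value_generator)
qed simp

lemma word_value_pres_eq:
  assumes "\<And>r. r \<in> R \<Longrightarrow> val r = \<one>"
  shows "pres_eq R u v \<Longrightarrow> val u = val v"
proof (induction rule: pres_eq.induct)
  case (pe_cancel u x v)
  have "letter_value G h x \<otimes> (inv (letter_value G h x) \<otimes> val v) = val v"
    by (simp add: m_assoc[symmetric])
  then show ?case by (simp add: word_value_append word_value_Cons letter_value_inv)
next
  case (pe_rel r u v)
  then show ?case using assms by (simp add: word_value_append)
qed simp_all

text \<open>This is von Dyck's theorem: a class is evaluated at any representative, since
  \<open>val\<close> is constant on classes.\<close>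

lemma pres_group_hom_exists:
  assumes "\<And>r. r \<in> R \<Longrightarrow> val r = \<one>"
  obtains \<phi> where "\<phi> \<in> hom (pres_group R) G" "\<And>w. \<phi> (word_class R w) = val w"
proof -
  define \<phi> where "\<phi> A = val (SOME w. w \<in> A)" for A
  have \<phi>: "\<phi> (word_class R w) = val w" for w
  proof -
    have "(SOME v. v \<in> word_class R w) \<in> word_class R w"
      by (rule someI[of _ w]) (simp add: word_class_def pe_refl)
    then show ?thesis
      unfolding \<phi>_def using word_value_pres_eq[OF assms] by (auto simp: word_class_def)
  qed
  then have "\<phi> \<in> hom (pres_group R) G"
    by (auto simp: hom_def carrier_pres_group word_class_mult word_value_append)
  then show thesis using \<phi> that by blast
qed

end

section \<open>Recursive enumerability\<close>

text \<open>This serves to read off the value of the searched function from a successful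
  \<open>Mu\<close> search.\<close>

lemma eval_deterministic: "eval f xs y \<Longrightarrow> eval f xs z \<Longrightarrow> y = z"
proof (induction arbitrary: z rule: eval.induct)
  case (ev_zero xs) then show ?case by (auto elim: eval.cases)
next
  case (ev_succ x xs) then show ?case by (auto elim: eval.cases)
next
  case (ev_proj i xs) from ev_proj.prems show ?case by cases auto
next
  case (ev_comp xs gs ys f z z')
  from ev_comp.prems show ?case
  proof cases
    case (ev_comp ys')
    have "ys = ys'"
      using ev_comp.IH(1) ev_comp(1) by (auto simp: list_all2_conv_all_nth intro: nth_equalityI)
    then show ?thesis using ev_comp ev_comp.IH(2) by blast
  qed
next
  case (ev_prim0 f xs y g) from ev_prim0.prems show ?case by cases (use ev_prim0.IH in auto)
next
  case (ev_primS f g n xs r y) from ev_primS.prems show ?case by cases (use ev_primS.IH in auto)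
next
  case (ev_mu f y xs)
  from ev_mu.prems show ?case
  proof cases
    case prems: ev_mu
    \<comment> \<open>If the two results differed, the searched function would take both 0 and a
      successor at the smaller one.\<close>
    then show ?thesis using ev_mu.IH by (metis nat.distinct(1) nat_neq_iff)
  qed
qed

text \<open>The arbitrary tail \<open>xs\<close> lets one program serve at every larger arity, as
  composition and recursion require.\<close>

definition computable :: "(nat \<Rightarrow> nat) \<Rightarrow> bool" where
  "computable F \<longleftrightarrow> (\<exists>f. \<forall>n xs. eval f (n # xs) (F n))"

definition computable2 :: "(nat \<Rightarrow> nat \<Rightarrow> nat) \<Rightarrow> bool" where
  "computable2 F \<longleftrightarrow> (\<exists>f. \<forall>m n xs. eval f (m # n # xs) (F m n))"

lemma eval_Proj0: "eval (Proj 0) (x # xs) x"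
  using ev_proj[of 0 "x # xs"] by simp

lemma eval_Proj1: "eval (Proj (Suc 0)) (x # y # xs) y"
  using ev_proj[of "Suc 0" "x # y # xs"] by simp

lemma eval_Comp1: "eval g xs y \<Longrightarrow> eval f [y] z \<Longrightarrow> eval (Comp f [g]) xs z"
  by (rule ev_comp[where ys = "[y]"]) auto

lemma eval_Comp2:
  "eval g xs y \<Longrightarrow> eval h xs y' \<Longrightarrow> eval f [y, y'] z \<Longrightarrow> eval (Comp f [g, h]) xs z"
  by (rule ev_comp[where ys = "[y, y']"]) auto

lemma computable_id: "computable (\<lambda>n. n)"
  unfolding computable_def using eval_Proj0 by blast

lemma computable_Suc: "computable Suc"
  unfolding computable_def using ev_succ by blast

lemma computable_comp:
  assumes "computable F" "computable G"
  shows "computable (\<lambda>n. F (G n))"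
proof -
  obtain f g where "\<And>n xs. eval f (n # xs) (F n)" "\<And>n xs. eval g (n # xs) (G n)"
    using assms unfolding computable_def by blast
  then have "eval (Comp f [g]) (n # xs) (F (G n))" for n xs by (intro eval_Comp1)
  then show ?thesis unfolding computable_def by blast
qed

lemma computable_comp2:
  assumes "computable2 F" "computable G" "computable H"
  shows "computable (\<lambda>n. F (G n) (H n))"
proof -
  obtain f g h where "\<And>m n xs. eval f (m # n # xs) (F m n)"
    "\<And>n xs. eval g (n # xs) (G n)" "\<And>n xs. eval h (n # xs) (H n)"
    using assms unfolding computable_def computable2_def by blast
  then have "eval (Comp f [g, h]) (n # xs) (F (G n) (H n))" for n xs by (intro eval_Comp2)
  then show ?thesis unfolding computable_def by blast
qed

lemma computable2_comp2:
  assumes "computable2 F" "computable2 G" "computable2 H"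
  shows "computable2 (\<lambda>m n. F (G m n) (H m n))"
proof -
  obtain f g h where "\<And>m n xs. eval f (m # n # xs) (F m n)"
    "\<And>m n xs. eval g (m # n # xs) (G m n)" "\<And>m n xs. eval h (m # n # xs) (H m n)"
    using assms unfolding computable2_def by blast
  then have "eval (Comp f [g, h]) (m # n # xs) (F (G m n) (H m n))" for m n xs
    by (intro eval_Comp2)
  then show ?thesis unfolding computable2_def by blast
qed

lemma computable2_fst: "computable F \<Longrightarrow> computable2 (\<lambda>m n. F m)"
  unfolding computable_def computable2_def by blast

lemma computable2_snd:
  assumes "computable F"
  shows "computable2 (\<lambda>m n. F n)"
proof -
  obtain f where "\<And>n xs. eval f (n # xs) (F n)" using assms unfolding computable_def by blast
  then have "eval (Comp f [Proj (Suc 0)]) (m # n # xs) (F n)" for m n xs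
    by (intro eval_Comp1[OF eval_Proj1])
  then show ?thesis unfolding computable2_def by blast
qed

lemma computable2_comp:
  assumes "computable F" "computable2 G"
  shows "computable2 (\<lambda>m n. F (G m n))"
  using computable2_comp2[OF computable2_fst[OF assms(1)] assms(2) assms(2)] .

lemma computable_const: "computable (\<lambda>n. c)"
proof (induction c)
  case 0 show ?case unfolding computable_def using ev_zero by blast
next
  case (Suc c) show ?case by (rule computable_comp[OF computable_Suc Suc])
qed

text \<open>\<open>Prim\<close> passes the accumulator, then the counter, then the parameters; the
  step \<open>G\<close> reads only the first two.\<close>

lemma computable2_prim:
  assumes "computable F" "computable2 (\<lambda>r n. G r n)"
  shows "computable2 (\<lambda>m n. rec_nat (F n) (\<lambda>k r. G r k) m)"
proof -
  obtain f where f: "eval f (n # xs) (F n)" for n xs using assms(1) unfolding computable_def by blast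
  obtain g where g: "eval g (r # n # xs) (G r n)" for r n xs
    using assms(2) unfolding computable2_def by blast
  have "eval (Prim f g) (m # n # xs) (rec_nat (F n) (\<lambda>k r. G r k) m)" for m n xs
    by (induction m) (auto intro: ev_prim0 ev_primS f g)
  then show ?thesis unfolding computable2_def by blast
qed

lemma computable_prim:
  assumes "computable2 (\<lambda>r n. G r n)"
  shows "computable (rec_nat c (\<lambda>k r. G r k))"
  using computable_comp2[OF computable2_prim[OF computable_const assms] computable_id computable_const]
  by simp

lemma computable2_add: "computable2 (+)"
proof -
  have "rec_nat n (\<lambda>k r. Suc r) m = m + n" for m n :: nat by (induction m) auto
  then show ?thesis
    using computable2_prim[OF computable_id computable2_fst[OF computable_Suc]] by simp
qed

lemma computable_pred: "computable (\<lambda>n. n - 1)"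
proof -
  have "(\<lambda>n. n - 1) = rec_nat 0 (\<lambda>k r. k)"
  proof
    show "n - 1 = rec_nat 0 (\<lambda>k r. k) n" for n :: nat by (cases n) auto
  qed
  then show ?thesis using computable_prim[OF computable2_snd[OF computable_id], of 0] by (simp only:)
qed

text \<open>The arguments are swapped because recursion runs on the first one: it counts the
  predecessors taken of \<open>n\<close>.\<close>

lemma computable2_diff: "computable2 (\<lambda>m n. n - m)"
proof -
  have "rec_nat n (\<lambda>k r. r - 1) m = n - m" for m n :: nat by (induction m) auto
  then show ?thesis
    using computable2_prim[OF computable_id computable2_fst[OF computable_pred]] by simp
qed

lemma computable_triangle: "computable triangle"
proof -
  have "triangle = rec_nat 0 (\<lambda>k r. r + Suc k)"
  proof
    show "triangle n = rec_nat 0 (\<lambda>k r. r + Suc k) n" for n by (induction n) auto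
  qed
  then show ?thesis
    using computable_prim[OF computable2_comp2[OF computable2_add computable2_fst[OF computable_id]
      computable2_snd[OF computable_Suc]], of 0] by (simp only:)
qed

lemma computable2_prod_encode: "computable2 (\<lambda>m n. prod_encode (m, n))"
  unfolding prod_encode_def
  using computable2_comp2[OF computable2_add computable2_comp[OF computable_triangle computable2_add]
      computable2_fst[OF computable_id]] by simp

text \<open>An unbounded search for a preimage of \<open>m\<close> halts exactly when
  \<open>m\<close> is in the range.\<close>

lemma rec_enum_range:
  assumes "computable F"
  shows "rec_enum (range F)"
proof -
  \<comment> \<open>With truncated subtraction this sum is 0 exactly when
    \<open>F n = m\<close>.\<close>
  have "computable2 (\<lambda>n m. (F n - m) + (m - F n))"
    by (intro computable2_comp2[OF computable2_add]
        computable2_comp2[OF computable2_diff computable2_snd[OF computable_id] computable2_fst[OF assms]]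
        computable2_comp2[OF computable2_diff computable2_fst[OF assms] computable2_snd[OF computable_id]])
  then obtain d where d: "eval d (n # m # xs) ((F n - m) + (m - F n))" for n m xs
    unfolding computable2_def by blast
  have "(\<exists>y. eval (Mu d) [m] y) \<longleftrightarrow> m \<in> range F" for m
  proof
    assume "\<exists>y. eval (Mu d) [m] y"
    then obtain y where "eval d (y # [m]) 0" by (auto elim: eval.cases)
    with d[of y m "[]"] have "(F y - m) + (m - F y) = 0" using eval_deterministic by blast
    then show "m \<in> range F" by (intro range_eqI[of _ _ y]) simp
  next
    assume "m \<in> range F"
    then have ex: "\<exists>n. F n = m" by blast
    \<comment> \<open>\<open>ev_mu\<close> demands successor values at all smaller arguments, hence
      the least preimage.\<close>
    define y where "y = (LEAST n. F n = m)"
    have "F y = m" unfolding y_def using ex by (rule LeastI_ex)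
    moreover have "\<exists>k. eval d (z # [m]) (Suc k)" if "z < y" for z
    proof -
      have "F z \<noteq> m" using not_less_Least that unfolding y_def by blast
      then obtain k where "(F z - m) + (m - F z) = Suc k" by (cases "(F z - m) + (m - F z)") auto
      then show ?thesis using d[of z m "[]"] by auto
    qed
    ultimately have "eval (Mu d) [m] y" using d[of y m "[]"] by (intro ev_mu) auto
    then show "\<exists>y. eval (Mu d) [m] y" by blast
  qed
  then show ?thesis unfolding rec_enum_def by blast
qed

text \<open>Codes grow by adding letters in front, so computing a concatenation from two codes would
  require decoding one of them. Treating a word as the operation of prepending it turns
  concatenation into composition.\<close>

definition computable_prefix :: "(nat \<Rightarrow> word) \<Rightarrow> bool" where
  "computable_prefix U \<longleftrightarrow>
    (\<forall>W. computable (\<lambda>n. word_code (W n)) \<longrightarrow> computable (\<lambda>n. word_code (U n @ W n)))"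

lemma computable_prefix_append:
  "computable_prefix U \<Longrightarrow> computable_prefix V \<Longrightarrow> computable_prefix (\<lambda>n. U n @ V n)"
  unfolding computable_prefix_def by simp

lemma word_code_Cons: "word_code (l # w) = Suc (prod_encode (letter_code l, word_code w))"
  by (simp add: word_code_def)

lemma computable_code_Cons: "computable (\<lambda>c. Suc (prod_encode (letter_code l, c)))"
  by (rule computable_comp[OF computable_Suc
      computable_comp2[OF computable2_prod_encode computable_const computable_id]])

lemma computable_prefix_const: "computable_prefix (\<lambda>n. w)"
proof (induction w)
  case Nil show ?case by (simp add: computable_prefix_def)
next
  case (Cons l w)
  then show ?case
    unfolding computable_prefix_def
    using computable_comp[OF computable_code_Cons[of l]] by (auto simp: word_code_Cons)
qed

text \<open>Prepending a power of a letter iterates one fixed function on codes, which is primitive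
  recursion.\<close>

lemma computable_prefix_replicate: "computable_prefix (\<lambda>n. replicate n l)"
  unfolding computable_prefix_def
proof (intro allI impI)
  fix W :: "nat \<Rightarrow> word"
  assume W: "computable (\<lambda>n. word_code (W n))"
  have "rec_nat (word_code w) (\<lambda>k c. Suc (prod_encode (letter_code l, c))) m
      = word_code (replicate m l @ w)" for m w
    by (induction m) (auto simp: word_code_Cons)
  then show "computable (\<lambda>n. word_code (replicate n l @ W n))"
    using computable_comp2[OF computable2_prim[OF computable_id
        computable2_fst[OF computable_code_Cons[of l]]] computable_id W] by simp
qed

lemma computable_prefix_imp_computable:
  "computable_prefix U \<Longrightarrow> computable (\<lambda>n. word_code (U n))"
  unfolding computable_prefix_def
  by (drule spec[of _ "\<lambda>_. []"]) (simp add: computable_const)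

section \<open>The two-generator presentation\<close>

text \<open>The generator \<open>False\<close> stands for \<open>a\<close> and \<open>True\<close>
  for \<open>t\<close>; the odd exponents are those of
  \<open>two_generator_double_wreath\<close>.\<close>

definition tor_word :: "nat \<Rightarrow> word" where
  "tor_word i = word_commutator [(False, True)]
     (word_inv (replicate (2 * i + 1) (True, True)) @ [(False, True)] @ replicate (2 * i + 1) (True, True))"

text \<open>The bracketing follows the hypothesis of \<open>inverted_square_in_Tor\<close>, with
  \<open>tor_word i\<close> as \<open>x\<close> and \<open>tor_word (Suc i)\<close> as
  \<open>y\<close>.\<close>

definition tor_relator_step :: "nat \<Rightarrow> word" where
  "tor_relator_step i = tor_word i @ (tor_word (Suc i) @ tor_word (Suc i)) @ word_inv (tor_word i) @
     (tor_word (Suc i) @ tor_word (Suc i))"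

definition tor_relators :: "word set" where
  "tor_relators = insert (tor_word 0 @ tor_word 0) (range tor_relator_step)"

lemma computable_prefix_replicate_odd:
  "computable_prefix (\<lambda>n. replicate (2 * n + 1) l)"
  "computable_prefix (\<lambda>n. replicate (2 * Suc n + 1) l)"
proof -
  \<comment> \<open>The two exponents are \<open>2 * n + k\<close> with \<open>k = 1\<close> and
    \<open>k = 3\<close>.\<close>
  have "computable_prefix (\<lambda>n. replicate n l @ replicate n l @ replicate k l)" for k
    by (intro computable_prefix_append computable_prefix_replicate computable_prefix_const)
  from this[of 1] this[of 3]
  show "computable_prefix (\<lambda>n. replicate (2 * n + 1) l)"
    "computable_prefix (\<lambda>n. replicate (2 * Suc n + 1) l)"
    by (simp_all add: replicate_add[symmetric] mult_2 add.assoc numeral_3_eq_3 del: replicate.simps)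
qed

lemma tor_relators_recursive: "recursive_presentation tor_relators"
proof -
  have "computable_prefix tor_relator_step"
    unfolding tor_relator_step_def[abs_def] tor_word_def word_commutator_def
      word_inv_append word_inv_replicate word_inv_Cons word_inv_Nil
    by (intro computable_prefix_append computable_prefix_replicate_odd computable_prefix_const)
  \<comment> \<open>As a recursion step that ignores the accumulator, this enumerates the relators:
    the exceptional one is the value at 0, and step \<open>k\<close> gives the value at
    \<open>Suc k\<close>.\<close>
  then have "computable2 (\<lambda>r k. word_code (tor_relator_step k))"
    by (intro computable2_snd computable_prefix_imp_computable)
  from rec_enum_range[OF computable_prim[OF this, of "word_code (tor_word 0 @ tor_word 0)"]]
  have "rec_enum (range (rec_nat (word_code (tor_word 0 @ tor_word 0))
      (\<lambda>k r. word_code (tor_relator_step k))))" .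
  moreover have "range (rec_nat c (\<lambda>k r. F k)) = insert c (range F)" for c :: nat and F
  proof -
    have "rec_nat c (\<lambda>k r. F k) n \<in> insert c (range F)" for n by (cases n) auto
    moreover have "c \<in> range (rec_nat c (\<lambda>k r. F k))" by (rule range_eqI[of _ _ 0]) simp
    moreover have "F k \<in> range (rec_nat c (\<lambda>k r. F k))" for k by (rule range_eqI[of _ _ "Suc k"]) simp
    ultimately show ?thesis by blast
  qed
  ultimately show ?thesis
    by (simp add: recursive_presentation_def tor_relators_def image_image)
qed

lemma tor_word_in_Tor:
  "word_class tor_relators (tor_word i) \<in> Tor (pres_group tor_relators) (Suc i)"
proof (induction i)
  case 0
  interpret G: group "pres_group tor_relators" by (rule pres_group_group)
  have "word_class tor_relators (tor_word 0 @ tor_word 0) = \<one>\<^bsub>pres_group tor_relators\<^esub>"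
    by (rule word_class_relator) (simp add: tor_relators_def)
  then have "word_class tor_relators (tor_word 0) [^]\<^bsub>pres_group tor_relators\<^esub> (2::nat)
      = \<one>\<^bsub>pres_group tor_relators\<^esub>"
    by (simp add: numeral_2_eq_2 word_class_closed word_class_mult)
  then show ?case by (intro G.in_Tor_Suc[of _ 2]) (simp_all add: word_class_closed)
next
  case (Suc i)
  interpret G: group "pres_group tor_relators" by (rule pres_group_group)
  have "word_class tor_relators (tor_relator_step i) = \<one>\<^bsub>pres_group tor_relators\<^esub>"
    by (rule word_class_relator) (simp add: tor_relators_def)
  then show ?case
    by (intro G.inverted_square_in_Tor[OF Suc])
      (simp_all add: word_class_closed tor_relator_step_def word_class_mult word_class_inv[symmetric])
qed

text \<open>Evaluation in the double wreath product turns \<open>tor_word i\<close> into a copy of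
  \<open>seq_gen i\<close>. The \<open>i\<close>-fold shift sends it to a copy of
  \<open>seq_gen 0\<close>, which is nontrivial, against \<open>Tor_killed\<close>.\<close>

lemma tor_word_not_in_Tor:
  "word_class tor_relators (tor_word i) \<notin> Tor (pres_group tor_relators) i"
proof
  assume in_Tor: "word_class tor_relators (tor_word i) \<in> Tor (pres_group tor_relators) i"
  let ?H = signed_seq_group
  let ?W = "wreath ?H"
  let ?K = "wreath ?W"
  let ?\<iota> = "\<lambda>x. wreath_single ?W (wreath_single ?H x)"
  let ?f = "wreath_map (wreath_map seq_shift)"
  interpret H: group ?H by (rule signed_seq_group)
  interpret W: group ?W by (rule H.wreath_group)
  interpret K: group ?K by (rule W.wreath_group)
  have kills: "kills_torsion ?W (wreath_map seq_shift)" "kills_torsion ?K ?f"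
    using H.wreath_kills_torsion[OF seq_shift_kills_torsion] W.wreath_kills_torsion by blast+
  have "?\<iota> \<in> hom ?H ?K"
    using hom_compose[OF H.wreath_single_hom W.wreath_single_hom] by (simp add: comp_def)
  then interpret \<iota>: group_hom ?H ?K ?\<iota> by unfold_locales
  obtain a where a: "a \<in> carrier ?K"
    and comm: "\<And>i. commutator ?K a
      (inv\<^bsub>?K\<^esub> (wreath_shift ?W [^]\<^bsub>?K\<^esub> (2 * i + 1)) \<otimes>\<^bsub>?K\<^esub> a
        \<otimes>\<^bsub>?K\<^esub> (wreath_shift ?W [^]\<^bsub>?K\<^esub> (2 * i + 1))) = ?\<iota> (seq_gen i)"
    using H.two_generator_double_wreath[of seq_gen] seq_gen_closed by metis
  define h where "h b = (if b then wreath_shift ?W else a)" for b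
  interpret two_generated ?K h
    by unfold_locales (simp add: h_def a W.wreath_shift_closed)
  have val: "val (tor_word j) = ?\<iota> (seq_gen j)" for j
    unfolding tor_word_def word_value_commutator word_value_append word_value_inv
      word_value_replicate word_value_generator
    using comm[of j] a W.wreath_shift_closed by (simp add: h_def K.m_assoc del: K.nat_pow_Suc)
  have rel: "val r = \<one>\<^bsub>?K\<^esub>" if "r \<in> tor_relators" for r
  proof -
    consider "r = tor_word 0 @ tor_word 0" | j where "r = tor_relator_step j"
      using \<open>r \<in> tor_relators\<close> unfolding tor_relators_def by blast
    then show ?thesis
    proof cases
      case 1
      have "val r = ?\<iota> (seq_gen 0 \<otimes>\<^bsub>?H\<^esub> seq_gen 0)"
        by (simp add: 1 word_value_append val seq_gen_closed)
      then show ?thesis by (simp add: seq_gen_0_square)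
    next
      case 2
      have "val r = ?\<iota> (seq_gen j \<otimes>\<^bsub>?H\<^esub> (seq_gen (Suc j) \<otimes>\<^bsub>?H\<^esub> seq_gen (Suc j))
          \<otimes>\<^bsub>?H\<^esub> inv\<^bsub>?H\<^esub> (seq_gen j) \<otimes>\<^bsub>?H\<^esub> (seq_gen (Suc j) \<otimes>\<^bsub>?H\<^esub> seq_gen (Suc j)))"
        by (simp add: 2 tor_relator_step_def word_value_append word_value_inv val seq_gen_closed K.m_assoc)
      then show ?thesis by (simp add: seq_gen_inverts_square)
    qed
  qed
  obtain \<phi> where \<phi>: "\<phi> \<in> hom (pres_group tor_relators) ?K"
    "\<And>w. \<phi> (word_class tor_relators w) = val w"
    using pres_group_hom_exists[OF rel] by blast
  have "(?f ^^ i) (?\<iota> (seq_gen i)) = \<one>\<^bsub>?K\<^esub>"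
    using Tor_killed[OF pres_group_group K.is_group \<phi>(1) kills(2) in_Tor] by (simp add: \<phi>(2) val)
  \<comment> \<open>The wreath maps act entrywise, so they commute with the embedding
    \<open>?\<iota>\<close>.\<close>
  moreover have "(?f ^^ n) (?\<iota> x) = ?\<iota> ((seq_shift ^^ n) x)" for n x
    using kills(1) seq_shift_kills_torsion
    by (induction n) (simp_all add: W.wreath_map_single H.wreath_map_single kills_torsion_def)
  ultimately show False
    by (simp add: seq_shift_gen W.wreath_single_eq_one_iff H.wreath_single_eq_one_iff seq_gen_0_neq_one)
qed

theorem theorem6p3:
  shows "\<exists>R. recursive_presentation R \<and> TorLen_infinite (pres_group R)"
proof (intro exI conjI)
  show "recursive_presentation tor_relators" by (rule tor_relators_recursive)
  show "TorLen_infinite (pres_group tor_relators)"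
    \<comment> \<open>For every \<open>n\<close> the class of \<open>tor_word n\<close> lies in
      \<open>Tor_infty\<close>, through level \<open>Suc n\<close>, but not in level
      \<open>n\<close>.\<close>
    unfolding TorLen_infinite_def Tor_infty_def
    using tor_word_in_Tor tor_word_not_in_Tor by blast
qed

end
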